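(* Let $\gamma=-0.1$, $\zeta=1.1$, and let $h:\mathbb{R}\to[0,1]$ be $h(x)=\mathrm{clip}\big(\gamma+(\zeta-\gamma)\sigma(x),0,1\big)$. Put $\mathcal{L}=(\zeta-\gamma)/4$. Then the map $h$ is globally Lipschitz with constant $\mathcal{L}$: for all positive integers $m,n$ and all $A,\tilde A\in\mathbb{R}^{m\times n}$, setting $H_{ij}=h(A_{ij})$ and $\tilde H_{ij}=h(\tilde A_{ij})$, one has $$|\tilde H_{ij}-H_{ij}|\le \mathcal{L}\,|\tilde A_{ij}-A_{ij}|\qquad\text{for all }(i,j).$$ In particular, $$\|\tilde H-H\|_\infty\le \mathcal{L}\,\|\tilde A-A\|_\infty .$$
   Context: $\sigma(x)=1/(1+e^{-x})$ is the sigmoid function. $\mathrm{clip}(y,0,1)=\min\{\max\{y,0\},1\}$. For a matrix $E$, $\|E\|_\infty=\max_{i,j}|E_{ij}|$ is the entrywise maximum norm. *)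

theory Defs
  imports "HOL-Analysis.Analysis"
begin

definition sigmoid :: "real \<Rightarrow> real" where
  "sigmoid x = 1 / (1 + exp (- x))"

definition clip :: "real \<Rightarrow> real \<Rightarrow> real \<Rightarrow> real" where
  "clip y lo hi = min (max y lo) hi"

lemma clip_range: "lo \<le> hi \<Longrightarrow> clip y lo hi \<in> {lo..hi}"
  by (auto simp: clip_def)

text \<open>Entrywise maximum norm; the index types are finite and nonempty, so the maximum is attained.
  It is neither the operator norm nor the \<^const>\<open>norm\<close> of the type (which is Frobenius).\<close>

definition max_norm :: "real ^ 'n ^ 'm \<Rightarrow> real" where
  "max_norm E = Max (range (\<lambda>(i, j). \<bar>E $ i $ j\<bar>))"

end

theory Submission
  imports Defs
begin

text \<open>The sigmoid satisfies s' = s (1 - s) with values in (0, 1), and t (1 - t) is at most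
  1/4, so the mean value inequality makes it 1/4-Lipschitz (\<open>sigmoid_lipschitz\<close>).
  Scaling by \<zeta> - \<gamma> multiplies the constant, translating by \<gamma> leaves it alone,
  and clipping cannot increase distances (\<open>clip_nonexpansive\<close>); hence \<open>h\<close>
  has constant (\<zeta> - \<gamma>) / 4. The matrix claims apply this entry by entry.\<close>

lemma has_real_derivative_sigmoid:
  "(sigmoid has_real_derivative sigmoid x * (1 - sigmoid x)) (at x)"
proof -
  have pos: "1 + exp (- x) > 0"
    by (simp add: add_pos_pos)
  have "((\<lambda>x. 1 / (1 + exp (- x))) has_real_derivative exp (- x) / (1 + exp (- x))\<^sup>2) (at x)"
    using pos by (auto intro!: derivative_eq_intros simp: power2_eq_square)
  moreover have "exp (- x) / (1 + exp (- x))\<^sup>2 = sigmoid x * (1 - sigmoid x)"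
    using pos by (simp add: sigmoid_def power2_eq_square divide_simps)
  ultimately show ?thesis
    by (simp add: sigmoid_def [abs_def])
qed

lemma sigmoid_bounds: "0 < sigmoid x" "sigmoid x < 1"
  by (simp_all add: sigmoid_def add_pos_pos)

lemma sigmoid_lipschitz: "(1/4)-lipschitz_on UNIV sigmoid"
proof (rule lipschitz_onI)
  fix x y :: real
  have "norm (sigmoid z * (1 - sigmoid z)) \<le> 1/4" for z
  proof -
    \<comment> \<open>Expanding this square gives s (1 - s) \<le> 1/4, with equality at s = 1/2;
      \<open>sigmoid_bounds\<close> makes the product positive, so its norm is the product
      itself.\<close>
    have "0 \<le> (sigmoid z - 1/2)\<^sup>2"
      by simp
    then show ?thesis
      using sigmoid_bounds [of z] by (simp add: power2_eq_square algebra_simps abs_if)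
  qed
  then show "dist (sigmoid x) (sigmoid y) \<le> 1/4 * dist x y"
    unfolding dist_norm
    by (intro field_differentiable_bound [where S = UNIV])
      (auto intro: has_real_derivative_sigmoid)
qed simp

text \<open>Taking the maximum or the minimum with a fixed number is 1-Lipschitz, and so is their
  composition.\<close>

lemma clip_nonexpansive: "\<bar>clip y lo hi - clip z lo hi\<bar> \<le> \<bar>y - z\<bar>"
  by (auto simp: clip_def min_def max_def)

lemma entry_le_max_norm: "\<bar>E $ i $ j\<bar> \<le> max_norm E"
  unfolding max_norm_def by (rule Max_ge) (auto intro: range_eqI [of _ _ "(i, j)"])

lemma max_norm_leI:
  assumes "\<And>i j. \<bar>E $ i $ j\<bar> \<le> c"
  shows "max_norm E \<le> c"
  unfolding max_norm_def using assms by (subst Max_le_iff) auto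

theorem theorem1:
  fixes \<gamma> \<zeta> L :: real and h :: "real \<Rightarrow> real"
  assumes "\<gamma> = -0.1" and "\<zeta> = 1.1"
    and "\<And>x. h x = clip (\<gamma> + (\<zeta> - \<gamma>) * sigmoid x) 0 1"
    and "L = (\<zeta> - \<gamma>) / 4"
  shows "L-lipschitz_on UNIV h \<and>
    (\<forall>(A :: real ^ 'n ^ 'm) (A' :: real ^ 'n ^ 'm) H H'.
      (\<forall>i j. H $ i $ j = h (A $ i $ j)) \<longrightarrow>
      (\<forall>i j. H' $ i $ j = h (A' $ i $ j)) \<longrightarrow>
      (\<forall>i j. \<bar>H' $ i $ j - H $ i $ j\<bar> \<le> L * \<bar>A' $ i $ j - A $ i $ j\<bar>) \<and>
      max_norm (H' - H) \<le> L * max_norm (A' - A))"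
proof -
  have c: "\<zeta> - \<gamma> \<ge> 0" and L: "L \<ge> 0"
    using assms(1,2,4) by simp_all
  have h: "\<bar>h x - h y\<bar> \<le> L * \<bar>x - y\<bar>" for x y
  proof -
    \<comment> \<open>The offset \<gamma> cancels in the difference of the two unclipped
      values.\<close>
    have "\<bar>h x - h y\<bar> \<le> \<bar>(\<zeta> - \<gamma>) * (sigmoid x - sigmoid y)\<bar>"
      using clip_nonexpansive [of "\<gamma> + (\<zeta> - \<gamma>) * sigmoid x" 0 1 "\<gamma> + (\<zeta> - \<gamma>) * sigmoid y"]
      by (simp add: assms(3) right_diff_distrib)
    also have "\<dots> = (\<zeta> - \<gamma>) * \<bar>sigmoid x - sigmoid y\<bar>"
      using c by (simp add: abs_mult)
    also have "\<dots> \<le> (\<zeta> - \<gamma>) * (1/4 * \<bar>x - y\<bar>)"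
      using lipschitz_onD [OF sigmoid_lipschitz, of x y] c
      by (intro mult_left_mono) (simp_all add: dist_real_def)
    finally show ?thesis
      by (simp add: assms(4))
  qed
  have "L-lipschitz_on UNIV h"
    using h L by (intro lipschitz_onI) (simp_all add: dist_real_def)
  moreover have "max_norm (H' - H) \<le> L * max_norm (A' - A)"
    if "\<forall>i j. H $ i $ j = h (A $ i $ j)" "\<forall>i j. H' $ i $ j = h (A' $ i $ j)"
    for A A' H H' :: "real ^ 'n ^ 'm"
  proof (rule max_norm_leI)
    fix i j
    have "\<bar>(H' - H) $ i $ j\<bar> \<le> L * \<bar>(A' - A) $ i $ j\<bar>"
      using h that by simp
    \<comment> \<open>This bound no longer depends on the entry, so it also bounds the maximum over
      all entries; monotonicity of the product uses \<open>L \<ge> 0\<close>.\<close>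
    also have "\<dots> \<le> L * max_norm (A' - A)"
      using L by (intro mult_left_mono entry_le_max_norm)
    finally show "\<bar>(H' - H) $ i $ j\<bar> \<le> L * max_norm (A' - A)" .
  qed
  ultimately show ?thesis
    using h by simp
qed

end
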